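(* Let $m>1$ and let $X\ne\emptyset$ be a finite set. Let $k:X\times X\to[0,\infty)$ be symmetric and such that the induced graph with vertex set $X$ is connected, and let $L$ be the operator generated by $k$. Suppose that $u:[0,\infty)\times X\to(0,\infty)$ is $C^1$ in time and that the function $v=\frac{m}{m-1}u^{m-1}$ satisfies $$\partial_t v\ge(1-\lambda)\tilde{\Psi}_\Upsilon^{(m)}(v)-\frac{\mu}{t}v\quad\text{in }(0,\infty)\times X$$ with some constants $\lambda\in[0,1)$ and $\mu>0$. Let $0<t_1<t_2$ and $x_1,x_2\in X$. Then for any sequence of pairwise distinct points $(y_i)_{i=0,1,\dots,N}$ in $X$, $N\in\mathbb{N}$, such that $y_0=x_1$, $y_N=x_2$ and $k(y_{i-1},y_i)>0$ for $i\in\{1,\dots,N\}$, there holds $$t_1^\mu v(t_1,x_1)\le t_2^\mu v(t_2,x_2)+\frac{2N^2}{(1-\lambda)(\mu+1)(t_2-t_1)^2}\sum_{j=1}^N\frac{\tau_j^{\mu+1}-\tau_{j-1}^{\mu+1}}{k(y_{j-1},y_j)},$$ where $\tau_i=t_1+i\frac{t_2-t_1}{N}$, $i=0,1,\dots,N$. In particular, $$t_1^\mu v(t_1,x_1)\le t_2^\mu v(t_2,x_2)+\frac{2\,d(x_1,x_2)^2\,(t_2^{\mu+1}-t_1^{\mu+1})}{(1-\lambda)(\mu+1)\,k_{\min}\,(t_2-t_1)^2},$$ where $k_{\min}$ is the minimal positive weight of an edge, i.e. the minimum of the positive values of $k$ on $X\times X$.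
   Context: $k$ is assumed nontrivial with $k(x,x)=0$. The graph induced by $k$ has vertex set $X$, and $x,y$ are joined by an edge if and only if $k(x,y)>0$; the weight of that edge is $k(x,y)$. For $x_1,x_2\in X$, $d(x_1,x_2)$ denotes the minimal length of all paths connecting $x_1$ and $x_2$ in the graph, where the length of a path is its number of edges. $L$ is given by $Lf(x)=\sum_{y\in X}k(x,y)(f(y)-f(x))$. For $w:X\to(0,\infty)$ and $m>1$, $$\tilde{\Psi}_\Upsilon^{(m)}(w)(x)=\sum_{y\in X}k(x,y)\Big(\tfrac{m-1}{m}w(x)^2+\tfrac{(m-1)^2}{m}w(x)^{\frac{m-2}{m-1}}w(y)^{\frac{m}{m-1}}-(m-1)w(x)w(y)\Big).$$ For functions of $(t,x)$, this operator acts in the variable $x$ for each fixed $t$. Here $\mathbb{N}=\{1,2,\dots\}$. *)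

theory Defs
  imports "HOL-Analysis.Analysis" "Graph_Theory.Graph_Theory"
begin

(* An undirected edge between x and y is represented by the two arcs (x, y) and (y, x);
   the relation is symmetric whenever k is. *)
definition induced_graph :: "'a set \<Rightarrow> ('a \<Rightarrow> 'a \<Rightarrow> real) \<Rightarrow> 'a pair_pre_digraph" where
  "induced_graph X k = \<lparr>pverts = X, parcs = {(x, y). x \<in> X \<and> y \<in> X \<and> k x y > 0}\<rparr>"

(* An apath is the list of its arcs, so its length is the number of its edges;
   the empty list is a path from a vertex to itself. *)
definition graph_dist :: "'a set \<Rightarrow> ('a \<Rightarrow> 'a \<Rightarrow> real) \<Rightarrow> 'a \<Rightarrow> 'a \<Rightarrow> nat" where
  "graph_dist X k x y =
     (LEAST n. \<exists>p. pre_digraph.apath (with_proj (induced_graph X k)) x p y \<and> length p = n)"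

definition k_min :: "'a set \<Rightarrow> ('a \<Rightarrow> 'a \<Rightarrow> real) \<Rightarrow> real" where
  "k_min X k = Min {k x y | x y. x \<in> X \<and> y \<in> X \<and> k x y > 0}"

definition Psi_Upsilon ::
    "'a set \<Rightarrow> ('a \<Rightarrow> 'a \<Rightarrow> real) \<Rightarrow> real \<Rightarrow> ('a \<Rightarrow> real) \<Rightarrow> 'a \<Rightarrow> real" where
  "Psi_Upsilon X k m w x =
     (\<Sum>y\<in>X. k x y *
        ((m - 1) / m * (w x)\<^sup>2
         + (m - 1)\<^sup>2 / m * w x powr ((m - 2) / (m - 1)) * w y powr (m / (m - 1))
         - (m - 1) * w x * w y))"

(* Continuously differentiable on the closed half-line, with the one-sided derivative at 0. *)
definition C1_on_halfline :: "(real \<Rightarrow> real) \<Rightarrow> bool" where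
  "C1_on_halfline f \<longleftrightarrow>
     (\<exists>f'. (\<forall>t\<ge>0. (f has_real_derivative f' t) (at t within {0..})) \<and> continuous_on {0..} f')"

end

theory Submission
  imports Defs
begin

text \<open>
  Along an edge from \<open>x\<close> to \<open>y\<close> the function
  \<open>t\<^sup>\<mu> (W v(t, y) + (1 - W) v(t, x))\<close> interpolates between the two sides of the Harnack
  inequality when \<open>W\<close> grows from \<open>0\<close> to \<open>1\<close>. Completing the square shows that its derivative is
  at least \<open>- t\<^sup>\<mu> / (\<kappa> (t\<^sub>2 - t\<^sub>1)\<^sup>2)\<close>, \<open>\<kappa> = (1 - \<lambda>) k(x, y) / 2\<close>, provided that
  the differential inequality controls the square of the positive part of \<open>v(t, x) - v(t, y)\<close> at
  one endpoint: at \<open>y\<close> for \<open>m \<le> 2\<close>, with \<open>W = (t - t\<^sub>1)\<^sup>2 / (t\<^sub>2 - t\<^sub>1)\<^sup>2\<close>, and at \<open>x\<close> for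
  \<open>m \<ge> 2\<close>, with \<open>1 - W = (t\<^sub>2 - t)\<^sup>2 / (t\<^sub>2 - t\<^sub>1)\<^sup>2\<close>. Chaining edges, each on a time interval of
  length \<open>(t\<^sub>2 - t\<^sub>1) / N\<close>, gives the estimate along a path.
\<close>

section \<open>Scalar inequalities for the integrand of the operator\<close>

text \<open>For positive \<open>w\<close> this is the bracket in \<open>Psi_Upsilon\<close> divided
  by \<open>(w x)^2\<close>, in the variable \<open>r = w y / w x\<close>. It vanishes at
  \<open>r = 1\<close>.\<close>

definition upsilon_h :: "real \<Rightarrow> real \<Rightarrow> real" where
  "upsilon_h m r = (m - 1) / m + (m - 1)\<^sup>2 / m * r powr (m / (m - 1)) - (m - 1) * r"

text \<open>Weighted AM-GM for \<open>r\<close> and \<open>1\<close> with weights \<open>p\<close>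
  and \<open>1 - p\<close>; the right side is the tangent at \<open>1\<close> of a concave
  power.\<close>

lemma powr_le_affine:
  fixes r p :: real
  assumes "0 < r" "0 \<le> p" "p \<le> 1"
  shows "r powr p \<le> 1 + p * (r - 1)"
  using Youngs_inequality_0[of p "1 - p" r 1] assms by (simp add: algebra_simps)

text \<open>Bernoulli's inequality, obtained from the concave case with base \<open>r powr q\<close>
  and exponent \<open>1 / q\<close>.\<close>

lemma powr_ge_affine:
  fixes r q :: real
  assumes "0 < r" "1 \<le> q"
  shows "1 + q * (r - 1) \<le> r powr q"
proof -
  have "(r powr q) powr (1 / q) \<le> 1 + 1 / q * (r powr q - 1)"
    by (rule powr_le_affine) (use assms in auto)
  then have "r - 1 \<le> (r powr q - 1) / q"
    using assms by (simp add: powr_powr)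
  then show ?thesis
    using assms by (simp add: pos_le_divide_eq mult.commute)
qed

text \<open>Replacing the power by its tangent at \<open>1\<close> cancels the remaining affine
  terms exactly.\<close>

lemma upsilon_h_nonneg:
  assumes "1 < m" "0 < r"
  shows "0 \<le> upsilon_h m r"
proof -
  have "(m - 1)\<^sup>2 / m * (1 + m / (m - 1) * (r - 1)) \<le> (m - 1)\<^sup>2 / m * r powr (m / (m - 1))"
    by (intro mult_left_mono powr_ge_affine) (use assms in \<open>auto simp: field_simps\<close>)
  moreover have "(m - 1)\<^sup>2 / m * (1 + m / (m - 1) * (r - 1)) = (m - 1) * r - (m - 1) / m"
    using assms by (simp add: field_simps power2_eq_square)
  ultimately show ?thesis
    by (simp add: upsilon_h_def)
qed

lemma has_real_derivative_upsilon_h: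
  assumes "1 < m" "0 < r"
  shows "(upsilon_h m has_real_derivative (m - 1) * (r powr (1 / (m - 1)) - 1)) (at r)"
proof -
  have e: "m / (m - 1) - 1 = 1 / (m - 1)"
    using assms by (simp add: field_simps)
  have c: "(m - 1)\<^sup>2 / m * (m / (m - 1)) = m - 1"
    using assms by (simp add: field_simps power2_eq_square)
  have "(upsilon_h m has_real_derivative
      0 + (m - 1)\<^sup>2 / m * (m / (m - 1) * r powr (m / (m - 1) - 1)) - (m - 1) * 1) (at r)"
    unfolding upsilon_h_def[abs_def]
    by (intro DERIV_add DERIV_diff DERIV_cmult DERIV_const DERIV_ident has_real_derivative_powr assms)
  then show ?thesis
    by (simp only: e c mult.assoc[symmetric]) (simp add: algebra_simps)
qed

text \<open>The difference \<open>D\<close> of the two sides vanishes at \<open>1\<close>, and its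
  derivative compares \<open>s powr (1 / (m - 1))\<close> with its tangent at \<open>1\<close>. The
  exponent is at least 1 for \<open>m \<le> 2\<close> and at most 1 for \<open>m \<ge> 2\<close>, so
  \<open>D\<close> is monotone on the whole positive axis; its direction decides on which side of
  \<open>1\<close> the bound holds.\<close>

lemma upsilon_h_ge:
  assumes "1 < m" "0 < r" and side: "m \<le> 2 \<and> 1 \<le> r \<or> 2 \<le> m \<and> r \<le> 1"
  shows "(r - 1)\<^sup>2 / 2 \<le> upsilon_h m r"
proof -
  define D where "D = (\<lambda>s. upsilon_h m s - (s - 1)\<^sup>2 / 2)"
  define D' where "D' = (\<lambda>s. (m - 1) * (s powr (1 / (m - 1)) - 1) - (s - 1))"
  have D1: "D 1 = 0"
    using assms(1) by (simp add: D_def upsilon_h_def field_simps power2_eq_square)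
  have der: "(D has_real_derivative D' s) (at s)" if "0 < s" for s
    unfolding D_def D'_def
  proof (intro DERIV_diff has_real_derivative_upsilon_h that assms(1))
    show "((\<lambda>s. (s - 1)\<^sup>2 / 2) has_real_derivative s - 1) (at s)"
      by (auto intro!: derivative_eq_intros)
  qed
  from side have "0 \<le> D r"
  proof
    assume A: "m \<le> 2 \<and> 1 \<le> r"
    have "0 \<le> D' s" if "0 < s" for s
    proof -
      have "1 + 1 / (m - 1) * (s - 1) \<le> s powr (1 / (m - 1))"
        using powr_ge_affine[of s "1 / (m - 1)"] A that assms by simp
      then show ?thesis
        unfolding D'_def using assms(1) by (simp add: field_simps)
    qed
    then have ex: "\<exists>d. (D has_real_derivative d) (at s) \<and> 0 \<le> d" if "0 < s" for s
      using der[OF that] that by blast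
    have "D 1 \<le> D r"
      by (rule DERIV_nonneg_imp_nondecreasing) (use ex A in auto)
    then show ?thesis using D1 by simp
  next
    assume A: "2 \<le> m \<and> r \<le> 1"
    have "D' s \<le> 0" if "0 < s" for s
    proof -
      have "s powr (1 / (m - 1)) \<le> 1 + 1 / (m - 1) * (s - 1)"
        using powr_le_affine[of s "1 / (m - 1)"] A that assms by simp
      then show ?thesis
        unfolding D'_def using assms(1) by (simp add: field_simps)
    qed
    then have ex: "\<exists>d. (D has_real_derivative d) (at s) \<and> d \<le> 0" if "0 < s" for s
      using der[OF that] that by blast
    have "D 1 \<le> D r"
      by (rule DERIV_nonpos_imp_nonincreasing) (use ex A assms(2) in auto)
    then show ?thesis using D1 by simp
  qed
  then show ?thesis by (simp add: D_def)
qed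

section \<open>Lower bounds for the operator\<close>

text \<open>The exponents \<open>(m - 2) / (m - 1)\<close> and \<open>m / (m - 1)\<close> add up to
  2, so each term is homogeneous of degree 2 in \<open>(a, b)\<close>.\<close>

lemma upsilon_term_eq:
  assumes "1 < m" "0 < a" "0 < b"
  shows "(m - 1) / m * a\<^sup>2 + (m - 1)\<^sup>2 / m * a powr ((m - 2) / (m - 1)) * b powr (m / (m - 1))
      - (m - 1) * a * b = a\<^sup>2 * upsilon_h m (b / a)"
proof -
  have "(m - 2) / (m - 1) = 2 - m / (m - 1)"
    using assms by (simp add: field_simps)
  then have e: "a powr ((m - 2) / (m - 1)) * b powr (m / (m - 1)) = a\<^sup>2 * (b / a) powr (m / (m - 1))"
    using assms by (simp add: powr_diff powr_divide)
  have "a\<^sup>2 * ((m - 1) * (b / a)) = (m - 1) * a * b"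
    using assms by (simp add: power2_eq_square)
  then have "a\<^sup>2 * upsilon_h m (b / a) = (m - 1) / m * a\<^sup>2
      + (m - 1)\<^sup>2 / m * (a\<^sup>2 * (b / a) powr (m / (m - 1))) - (m - 1) * a * b"
    unfolding upsilon_h_def by (simp only: distrib_left right_diff_distrib mult_ac)
  then show ?thesis
    by (simp only: e[symmetric] mult_ac)
qed

lemma Psi_Upsilon_eq:
  assumes "1 < m" "x \<in> X" "\<And>y. y \<in> X \<Longrightarrow> 0 < w y"
  shows "Psi_Upsilon X k m w x = (\<Sum>y\<in>X. k x y * ((w x)\<^sup>2 * upsilon_h m (w y / w x)))"
  unfolding Psi_Upsilon_def
  by (intro sum.cong arg_cong2[of _ _ _ _ times] upsilon_term_eq assms refl)

lemma Psi_Upsilon_nonneg: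
  assumes "1 < m" "x \<in> X" "\<And>y. y \<in> X \<Longrightarrow> 0 < w y" "\<And>y. y \<in> X \<Longrightarrow> 0 \<le> k x y"
  shows "0 \<le> Psi_Upsilon X k m w x"
  using assms by (auto simp: Psi_Upsilon_eq intro!: sum_nonneg mult_nonneg_nonneg upsilon_h_nonneg)

text \<open>All summands are nonnegative, so the single neighbour \<open>y\<close> bounds the sum
  from below; its summand is estimated by \<open>upsilon_h_ge\<close> at the ratio
  \<open>w y / w x\<close>.\<close>

lemma Psi_Upsilon_ge:
  assumes "1 < m" "finite X" "x \<in> X" "y \<in> X"
    and "\<And>y. y \<in> X \<Longrightarrow> 0 < w y" "\<And>y. y \<in> X \<Longrightarrow> 0 \<le> k x y"
    and side: "m \<le> 2 \<and> w x \<le> w y \<or> 2 \<le> m \<and> w y \<le> w x"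
  shows "k x y * (w y - w x)\<^sup>2 / 2 \<le> Psi_Upsilon X k m w x"
proof -
  have pos: "0 < w x" "0 < w y" using assms by auto
  have "(w y / w x - 1)\<^sup>2 / 2 \<le> upsilon_h m (w y / w x)"
    using side pos by (intro upsilon_h_ge assms) auto
  then have "(w x)\<^sup>2 * ((w y / w x - 1)\<^sup>2 / 2) \<le> (w x)\<^sup>2 * upsilon_h m (w y / w x)"
    by (intro mult_left_mono) auto
  moreover have "(w x)\<^sup>2 * ((w y / w x - 1)\<^sup>2 / 2) = (w y - w x)\<^sup>2 / 2"
    using pos by (simp add: field_simps power2_eq_square)
  ultimately have "k x y * ((w y - w x)\<^sup>2 / 2) \<le> k x y * ((w x)\<^sup>2 * upsilon_h m (w y / w x))"
    using assms by (intro mult_left_mono) auto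
  also have "\<dots> \<le> Psi_Upsilon X k m w x"
  proof -
    have eq: "Psi_Upsilon X k m w x = (\<Sum>y\<in>X. k x y * ((w x)\<^sup>2 * upsilon_h m (w y / w x)))"
      using assms by (intro Psi_Upsilon_eq) auto
    show ?thesis
      unfolding eq
      by (rule member_le_sum[of y X "\<lambda>y. k x y * ((w x)\<^sup>2 * upsilon_h m (w y / w x))"])
        (use assms pos in \<open>auto intro!: mult_nonneg_nonneg upsilon_h_nonneg\<close>)
  qed
  finally show ?thesis by simp
qed

section \<open>Monotone interpolation between two endpoint functions\<close>

text \<open>Completing the square: the gap is \<open>(c * x / 2 - 1)^2 / c\<close>.\<close>

lemma le_quadratic_add_inverse:
  fixes x c :: real
  assumes "0 < c"
  shows "x \<le> c * x\<^sup>2 / 4 + 1 / c"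
proof -
  have "c * x\<^sup>2 / 4 + 1 / c - x = (c * x / 2 - 1)\<^sup>2 / c"
    using assms by (simp add: field_simps power2_eq_square)
  moreover have "0 \<le> (c * x / 2 - 1)\<^sup>2 / c" using assms by simp
  ultimately show ?thesis by linarith
qed

text \<open>The integrating factor \<open>t powr mu\<close> absorbs the term
  \<open>mu / t * v\<close> of the differential inequality.\<close>

lemma has_real_derivative_powr_times:
  fixes f :: "real \<Rightarrow> real"
  assumes "0 < t" "(f has_real_derivative f') (at t)"
  shows "((\<lambda>s. s powr mu * f s) has_real_derivative t powr mu * (f' + mu / t * f t)) (at t)"
proof -
  have "((\<lambda>s. s powr mu * f s) has_real_derivative
      mu * t powr (mu - 1) * f t + f' * t powr mu) (at t)"
    by (intro DERIV_mult has_real_derivative_powr assms)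
  then show ?thesis
    using assms by (simp add: powr_diff field_simps)
qed

text \<open>
  The weights \<open>\<alpha>\<close> and \<open>\<beta>\<close> say at which endpoint the quadratic lower bound is available; only
  the cases \<open>(0, 1)\<close> and \<open>(1, 0)\<close> occur.
\<close>

lemma weighted_harnack:
  fixes a b a' b' W W' :: "real \<Rightarrow> real"
  assumes "0 < kap" "0 < mu" "0 < t1" "t1 < t2"
    and a: "\<And>t. t1 \<le> t \<Longrightarrow> t \<le> t2 \<Longrightarrow> (a has_real_derivative a' t) (at t)"
    and b: "\<And>t. t1 \<le> t \<Longrightarrow> t \<le> t2 \<Longrightarrow> (b has_real_derivative b' t) (at t)"
    and W: "\<And>t. t1 \<le> t \<Longrightarrow> t \<le> t2 \<Longrightarrow> (W has_real_derivative W' t) (at t)"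
    and ends: "W t1 = 0" "W t2 = 1"
    and range: "\<And>t. t1 \<le> t \<Longrightarrow> t \<le> t2 \<Longrightarrow> 0 \<le> W t \<and> W t \<le> 1 \<and> 0 \<le> W' t"
    and W': "\<And>t. t1 \<le> t \<Longrightarrow> t \<le> t2 \<Longrightarrow>
      (W' t)\<^sup>2 * (t2 - t1)\<^sup>2 \<le> 4 * (\<alpha> * (1 - W t) + \<beta> * W t)"
    and a': "\<And>t. t1 \<le> t \<Longrightarrow> t \<le> t2 \<Longrightarrow> \<alpha> * kap * (max 0 (a t - b t))\<^sup>2 \<le> a' t + mu / t * a t"
    and b': "\<And>t. t1 \<le> t \<Longrightarrow> t \<le> t2 \<Longrightarrow> \<beta> * kap * (max 0 (a t - b t))\<^sup>2 \<le> b' t + mu / t * b t"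
  shows "t1 powr mu * a t1 \<le> t2 powr mu * b t2
      + (t2 powr (mu + 1) - t1 powr (mu + 1)) / (kap * (mu + 1) * (t2 - t1)\<^sup>2)"
proof -
  define c where "c = kap * (t2 - t1)\<^sup>2"
  have c: "0 < c" using assms by (simp add: c_def)
  \<comment> \<open>The last summand is an antiderivative of \<open>t powr mu / c\<close>. It pays
    for the loss \<open>1 / c\<close> in completing the square, so \<open>F\<close> is
    nondecreasing, and its increment is the error term of the claim.\<close>
  define F where "F = (\<lambda>t. W t * (t powr mu * b t) + (1 - W t) * (t powr mu * a t)
      + t powr (mu + 1) / (c * (mu + 1)))"
  define F' where "F' = (\<lambda>t. t powr mu * (W t * (b' t + mu / t * b t)
      + (1 - W t) * (a' t + mu / t * a t) - W' t * (a t - b t) + 1 / c))"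
  have der: "(F has_real_derivative F' t) (at t)" if t: "t1 \<le> t" "t \<le> t2" for t
  proof -
    have "0 < t" using t assms by simp
    have "(F has_real_derivative
       (W' t * (t powr mu * b t) + (t powr mu * (b' t + mu / t * b t)) * W t)
       + ((0 - W' t) * (t powr mu * a t) + (t powr mu * (a' t + mu / t * a t)) * (1 - W t))
       + ((mu + 1) * t powr (mu + 1 - 1)) / (c * (mu + 1))) (at t)"
      unfolding F_def
      by (intro DERIV_add DERIV_mult DERIV_diff DERIV_const DERIV_cdivide W a b t \<open>0 < t\<close>
          has_real_derivative_powr has_real_derivative_powr_times)
    moreover have "((mu + 1) * t powr (mu + 1 - 1)) / (c * (mu + 1)) = t powr mu * (1 / c)"
      using assms by simp
    ultimately show ?thesis
      unfolding F'_def by (simp only: algebra_simps mult_zero_left mult_1_left add_0_left)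
  qed
  have nonneg: "0 \<le> F' t" if t: "t1 \<le> t" "t \<le> t2" for t
  proof -
    \<comment> \<open>Since \<open>W' \<ge> 0\<close>, only the positive part of
      \<open>a - b\<close> can make the derivative smaller.\<close>
    define G where "G = max 0 (a t - b t)"
    have "W' t * (a t - b t) \<le> W' t * G"
      using range[OF t] by (intro mult_left_mono) (auto simp: G_def)
    also have "\<dots> \<le> c * (W' t * G)\<^sup>2 / 4 + 1 / c"
      using c by (rule le_quadratic_add_inverse)
    also have "c * (W' t * G)\<^sup>2 / 4 = kap * G\<^sup>2 / 4 * ((W' t)\<^sup>2 * (t2 - t1)\<^sup>2)"
      by (simp add: c_def power_mult_distrib)
    \<comment> \<open>The condition on \<open>W'\<close> enters here; its factor 4 cancels the 4
      from completing the square.\<close>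
    also have "\<dots> \<le> kap * G\<^sup>2 / 4 * (4 * (\<alpha> * (1 - W t) + \<beta> * W t))"
      using assms(1) by (intro mult_left_mono W' t) auto
    also have "\<dots> = (1 - W t) * (\<alpha> * kap * G\<^sup>2) + W t * (\<beta> * kap * G\<^sup>2)"
      by (simp add: algebra_simps)
    also have "\<dots> \<le> (1 - W t) * (a' t + mu / t * a t) + W t * (b' t + mu / t * b t)"
      using range[OF t] a'[OF t] b'[OF t] by (intro add_mono mult_left_mono) (auto simp: G_def)
    finally show ?thesis by (simp add: F'_def)
  qed
  have ex: "\<exists>d. (F has_real_derivative d) (at t) \<and> 0 \<le> d" if "t1 \<le> t" "t \<le> t2" for t
    using der[OF that] nonneg[OF that] by blast
  have "F t1 \<le> F t2"
    by (rule DERIV_nonneg_imp_nondecreasing) (use ex assms(4) in auto)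
  then show ?thesis
    by (simp add: F_def ends c_def diff_divide_distrib mult_ac)
qed

lemma square_scaled:
  fixes x c :: real
  assumes "c \<noteq> 0"
  shows "(2 * x / c\<^sup>2)\<^sup>2 * c\<^sup>2 = 4 * (x\<^sup>2 / c\<^sup>2)"
  using assms by (simp add: field_simps power2_eq_square)

text \<open>For \<open>\<alpha> = 0\<close>, \<open>\<beta> = 1\<close> the condition on the weight
  reads \<open>W' * (t2 - t1) \<le> 2 * sqrt W\<close>. The quadratic weight attains equality and
  grows from 0 at \<open>t1\<close> to exactly 1 at \<open>t2\<close>.\<close>

lemma weighted_harnack_at_end:
  fixes a b a' b' :: "real \<Rightarrow> real"
  assumes "0 < kap" "0 < mu" "0 < t1" "t1 < t2"
    and a: "\<And>t. t1 \<le> t \<Longrightarrow> t \<le> t2 \<Longrightarrow> (a has_real_derivative a' t) (at t)"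
    and b: "\<And>t. t1 \<le> t \<Longrightarrow> t \<le> t2 \<Longrightarrow> (b has_real_derivative b' t) (at t)"
    and a': "\<And>t. t1 \<le> t \<Longrightarrow> t \<le> t2 \<Longrightarrow> 0 \<le> a' t + mu / t * a t"
    and b': "\<And>t. t1 \<le> t \<Longrightarrow> t \<le> t2 \<Longrightarrow> kap * (max 0 (a t - b t))\<^sup>2 \<le> b' t + mu / t * b t"
  shows "t1 powr mu * a t1 \<le> t2 powr mu * b t2
      + (t2 powr (mu + 1) - t1 powr (mu + 1)) / (kap * (mu + 1) * (t2 - t1)\<^sup>2)"
proof (rule weighted_harnack[OF assms(1-4) a b, where \<alpha> = 0 and \<beta> = 1
      and W = "\<lambda>t. (t - t1)\<^sup>2 / (t2 - t1)\<^sup>2" and W' = "\<lambda>t. 2 * (t - t1) / (t2 - t1)\<^sup>2"])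
  fix t assume t: "t1 \<le> t" "t \<le> t2"
  show "((\<lambda>t. (t - t1)\<^sup>2 / (t2 - t1)\<^sup>2) has_real_derivative 2 * (t - t1) / (t2 - t1)\<^sup>2) (at t)"
    by (rule DERIV_cdivide) (auto intro!: derivative_eq_intros)
  have "(t - t1)\<^sup>2 \<le> (t2 - t1)\<^sup>2"
    using t by (intro power_mono) auto
  then show "0 \<le> (t - t1)\<^sup>2 / (t2 - t1)\<^sup>2 \<and> (t - t1)\<^sup>2 / (t2 - t1)\<^sup>2 \<le> 1 \<and>
      0 \<le> 2 * (t - t1) / (t2 - t1)\<^sup>2"
    using t assms by simp
  show "(2 * (t - t1) / (t2 - t1)\<^sup>2)\<^sup>2 * (t2 - t1)\<^sup>2
      \<le> 4 * (0 * (1 - (t - t1)\<^sup>2 / (t2 - t1)\<^sup>2) + 1 * ((t - t1)\<^sup>2 / (t2 - t1)\<^sup>2))"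
    using \<open>t1 < t2\<close> by (subst square_scaled) auto
qed (use assms a' b' in auto)

text \<open>The time-reversed choice: now \<open>1 - W\<close> is quadratic, with equality in
  \<open>(W')^2 * (t2 - t1)^2 = 4 * (1 - W)\<close>.\<close>

lemma weighted_harnack_at_start:
  fixes a b a' b' :: "real \<Rightarrow> real"
  assumes "0 < kap" "0 < mu" "0 < t1" "t1 < t2"
    and a: "\<And>t. t1 \<le> t \<Longrightarrow> t \<le> t2 \<Longrightarrow> (a has_real_derivative a' t) (at t)"
    and b: "\<And>t. t1 \<le> t \<Longrightarrow> t \<le> t2 \<Longrightarrow> (b has_real_derivative b' t) (at t)"
    and a': "\<And>t. t1 \<le> t \<Longrightarrow> t \<le> t2 \<Longrightarrow> kap * (max 0 (a t - b t))\<^sup>2 \<le> a' t + mu / t * a t"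
    and b': "\<And>t. t1 \<le> t \<Longrightarrow> t \<le> t2 \<Longrightarrow> 0 \<le> b' t + mu / t * b t"
  shows "t1 powr mu * a t1 \<le> t2 powr mu * b t2
      + (t2 powr (mu + 1) - t1 powr (mu + 1)) / (kap * (mu + 1) * (t2 - t1)\<^sup>2)"
proof (rule weighted_harnack[OF assms(1-4) a b, where \<alpha> = 1 and \<beta> = 0
      and W = "\<lambda>t. 1 - (t2 - t)\<^sup>2 / (t2 - t1)\<^sup>2" and W' = "\<lambda>t. 2 * (t2 - t) / (t2 - t1)\<^sup>2"])
  fix t assume t: "t1 \<le> t" "t \<le> t2"
  have "((\<lambda>t. 1 - (t2 - t)\<^sup>2 / (t2 - t1)\<^sup>2) has_real_derivative
      0 - (- (2 * (t2 - t))) / (t2 - t1)\<^sup>2) (at t)"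
    by (intro DERIV_diff DERIV_const DERIV_cdivide) (auto intro!: derivative_eq_intros)
  then show "((\<lambda>t. 1 - (t2 - t)\<^sup>2 / (t2 - t1)\<^sup>2) has_real_derivative
      2 * (t2 - t) / (t2 - t1)\<^sup>2) (at t)"
    by (simp only: minus_divide_left[symmetric] diff_minus_eq_add add_0_left)
  have "(t2 - t)\<^sup>2 \<le> (t2 - t1)\<^sup>2"
    using t by (intro power_mono) auto
  then show "0 \<le> 1 - (t2 - t)\<^sup>2 / (t2 - t1)\<^sup>2 \<and> 1 - (t2 - t)\<^sup>2 / (t2 - t1)\<^sup>2 \<le> 1 \<and>
      0 \<le> 2 * (t2 - t) / (t2 - t1)\<^sup>2"
    using t assms by simp
  show "(2 * (t2 - t) / (t2 - t1)\<^sup>2)\<^sup>2 * (t2 - t1)\<^sup>2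
      \<le> 4 * (1 * (1 - (1 - (t2 - t)\<^sup>2 / (t2 - t1)\<^sup>2)) + 0 * (1 - (t2 - t)\<^sup>2 / (t2 - t1)\<^sup>2))"
    using \<open>t1 < t2\<close> by (subst square_scaled) auto
qed (use assms a' b' in auto)

section \<open>From the differential inequality to edges and paths\<close>

text \<open>Collects the facts about \<open>v\<close> at positive times on which the estimates rest.
  The vertex is the first argument of \<open>v'\<close>, so that \<open>v' x\<close> is a function
  of time.\<close>

locale li_yau_inequality =
  fixes X :: "'a set" and k :: "'a \<Rightarrow> 'a \<Rightarrow> real" and m lam mu :: real
    and v :: "real \<Rightarrow> 'a \<Rightarrow> real" and v' :: "'a \<Rightarrow> real \<Rightarrow> real"
  assumes m: "1 < m" and finite: "finite X" and lam: "lam < 1" and mu: "0 < mu"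
    and k: "\<And>x y. x \<in> X \<Longrightarrow> y \<in> X \<Longrightarrow> 0 \<le> k x y" "\<And>x y. x \<in> X \<Longrightarrow> y \<in> X \<Longrightarrow> k x y = k y x"
    and pos: "\<And>t x. 0 < t \<Longrightarrow> x \<in> X \<Longrightarrow> 0 < v t x"
    and der: "\<And>t x. 0 < t \<Longrightarrow> x \<in> X \<Longrightarrow> ((\<lambda>s. v s x) has_real_derivative v' x t) (at t)"
    and ineq: "\<And>t x. 0 < t \<Longrightarrow> x \<in> X \<Longrightarrow>
      (1 - lam) * Psi_Upsilon X k m (v t) x - mu / t * v t x \<le> v' x t"
begin

lemma time_derivative_ge:
  assumes "0 < t" "z \<in> X" "c \<le> (1 - lam) * Psi_Upsilon X k m (v t) z"
  shows "c \<le> v' z t + mu / t * v t z"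
  using ineq[OF assms(1,2)] assms(3) by linarith

lemma time_derivative_nonneg:
  assumes "0 < t" "z \<in> X"
  shows "0 \<le> v' z t + mu / t * v t z"
  using assms m lam k pos by (intro time_derivative_ge mult_nonneg_nonneg Psi_Upsilon_nonneg) auto

text \<open>Settles the empty path: nonnegativity of the operator makes
  \<open>t powr mu * v t x\<close> nondecreasing.\<close>

lemma harnack_vertex:
  assumes "0 < t1" "t1 < t2" "x \<in> X"
  shows "t1 powr mu * v t1 x \<le> t2 powr mu * v t2 x"
proof (rule DERIV_nonneg_imp_nondecreasing[of t1 t2 "\<lambda>t. t powr mu * v t x"])
  fix t assume t: "t1 \<le> t" "t \<le> t2"
  then show "\<exists>D. ((\<lambda>t. t powr mu * v t x) has_real_derivative D) (at t) \<and> 0 \<le> D"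
    using assms has_real_derivative_powr_times[OF _ der, of t x mu] time_derivative_nonneg[of t x] by force
qed (use assms in simp)

lemma harnack_edge:
  assumes "0 < t1" "t1 < t2" "x \<in> X" "y \<in> X" "0 < k x y"
  shows "t1 powr mu * v t1 x \<le> t2 powr mu * v t2 y
      + 2 * (t2 powr (mu + 1) - t1 powr (mu + 1)) / ((1 - lam) * k x y * (mu + 1) * (t2 - t1)\<^sup>2)"
proof -
  define kap where "kap = (1 - lam) * k x y / 2"
  have kap: "0 < kap" using assms lam by (simp add: kap_def)
  \<comment> \<open>Stated for either orientation of the edge: \<open>z\<close> is the endpoint
    whose differential inequality is used, \<open>w\<close> its neighbour.\<close>
  have sq: "kap * (v t w - v t z)\<^sup>2 \<le> v' z t + mu / t * v t z"
    if "0 < t" "z \<in> X" "w \<in> X" "k z w = k x y"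
      and "m \<le> 2 \<and> v t z \<le> v t w \<or> 2 \<le> m \<and> v t w \<le> v t z" for t z w
  proof (rule time_derivative_ge)
    have "k z w * (v t w - v t z)\<^sup>2 / 2 \<le> Psi_Upsilon X k m (v t) z"
      using that pos k by (intro Psi_Upsilon_ge m finite) auto
    then have "(1 - lam) * (k z w * (v t w - v t z)\<^sup>2 / 2) \<le> (1 - lam) * Psi_Upsilon X k m (v t) z"
      using lam by (intro mult_left_mono) auto
    then show "kap * (v t w - v t z)\<^sup>2 \<le> (1 - lam) * Psi_Upsilon X k m (v t) z"
      using that by (simp add: kap_def mult_ac)
  qed (use that in auto)
  have "t1 powr mu * v t1 x \<le> t2 powr mu * v t2 y
      + (t2 powr (mu + 1) - t1 powr (mu + 1)) / (kap * (mu + 1) * (t2 - t1)\<^sup>2)"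
  proof (cases "m \<le> 2")
    case True
    \<comment> \<open>Where \<open>v t x \<ge> v t y\<close>, the smaller value sits at
      \<open>y\<close>, the side on which the quadratic bound holds for \<open>m \<le> 2\<close>.
      Elsewhere the left side is 0.\<close>
    have "kap * (max 0 (v t x - v t y))\<^sup>2 \<le> v' y t + mu / t * v t y" if "t1 \<le> t" for t
      using sq[of t y x] time_derivative_nonneg[of t y] k(2)[of x y] True that assms(1,3,4)
      by (auto simp: max_def)
    then show ?thesis
      using assms mu
      by (intro weighted_harnack_at_end[where a = "\<lambda>t. v t x" and b = "\<lambda>t. v t y"
            and a' = "v' x" and b' = "v' y"] kap der time_derivative_nonneg) auto
  next
    case False
    \<comment> \<open>For \<open>m > 2\<close> the quadratic bound needs the larger value at the
      centre, which is now \<open>x\<close>.\<close>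
    have "kap * (max 0 (v t x - v t y))\<^sup>2 \<le> v' x t + mu / t * v t x" if "t1 \<le> t" for t
      using sq[of t x y] time_derivative_nonneg[of t x] False that assms(1,3,4)
      by (auto simp: max_def power2_commute)
    then show ?thesis
      using assms mu
      by (intro weighted_harnack_at_start[where a = "\<lambda>t. v t x" and b = "\<lambda>t. v t y"
            and a' = "v' x" and b' = "v' y"] kap der time_derivative_nonneg) auto
  qed
  then show ?thesis
    by (simp add: kap_def mult_ac)
qed

text \<open>Edge estimates are chained over \<open>N\<close> equal time intervals, one per
  edge.\<close>

lemma harnack_path:
  fixes t1 t2 :: real and N :: nat and y :: "nat \<Rightarrow> 'a"
  defines "\<tau> \<equiv> (\<lambda>i::nat. t1 + real i * ((t2 - t1) / real N))"
  assumes "0 < t1" "t1 < t2" "1 \<le> N" and y: "\<And>i. i \<le> N \<Longrightarrow> y i \<in> X"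
    and edge: "\<And>i. i < N \<Longrightarrow> 0 < k (y i) (y (Suc i))"
  shows "t1 powr mu * v t1 (y 0) \<le> t2 powr mu * v t2 (y N)
      + 2 * (real N)\<^sup>2 / ((1 - lam) * (mu + 1) * (t2 - t1)\<^sup>2)
        * (\<Sum>j=1..N. (\<tau> j powr (mu + 1) - \<tau> (j - 1) powr (mu + 1)) / k (y (j - 1)) (y j))"
proof -
  define C where "C = 2 * (real N)\<^sup>2 / ((1 - lam) * (mu + 1) * (t2 - t1)\<^sup>2)"
  define S where "S = (\<lambda>j. (\<tau> j powr (mu + 1) - \<tau> (j - 1) powr (mu + 1)) / k (y (j - 1)) (y j))"
  \<comment> \<open>The factor \<open>N^2\<close> arises from the squared interval length
    \<open>(t2 - t1) / N\<close> in the denominator.\<close>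
  have scale: "2 * D / ((1 - lam) * K * (mu + 1) * ((t2 - t1) / real N)\<^sup>2) = C * (D / K)" for D K
    unfolding C_def by (simp add: power_divide mult_ac)
  \<comment> \<open>Induction over initial segments of the path: the first \<open>n\<close> edges
    consume the time from \<open>t1\<close> to \<open>\<tau> n\<close>.\<close>
  have "t1 powr mu * v t1 (y 0) \<le> \<tau> n powr mu * v (\<tau> n) (y n) + C * (\<Sum>j=1..n. S j)"
    if "n \<le> N" for n
    using that
  proof (induction n)
    case 0
    then show ?case by (simp add: \<tau>_def)
  next
    case (Suc n)
    have step: "\<tau> (Suc n) - \<tau> n = (t2 - t1) / real N"
      by (simp add: \<tau>_def distrib_right add_divide_distrib)
    have "0 < \<tau> n"
      using assms(2-4) by (simp add: \<tau>_def add_pos_nonneg)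
    moreover have "\<tau> n < \<tau> (Suc n)"
    proof -
      have "0 < (t2 - t1) / real N"
        using assms(3,4) by simp
      then show ?thesis
        using step by linarith
    qed
    ultimately have "\<tau> n powr mu * v (\<tau> n) (y n) \<le> \<tau> (Suc n) powr mu * v (\<tau> (Suc n)) (y (Suc n))
        + 2 * (\<tau> (Suc n) powr (mu + 1) - \<tau> n powr (mu + 1))
          / ((1 - lam) * k (y n) (y (Suc n)) * (mu + 1) * (\<tau> (Suc n) - \<tau> n)\<^sup>2)"
      using Suc.prems y edge by (intro harnack_edge) auto
    also have "2 * (\<tau> (Suc n) powr (mu + 1) - \<tau> n powr (mu + 1))
          / ((1 - lam) * k (y n) (y (Suc n)) * (mu + 1) * (\<tau> (Suc n) - \<tau> n)\<^sup>2) = C * S (Suc n)"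
      unfolding step scale S_def by simp
    finally show ?case
      using Suc by (simp add: distrib_left)
  qed
  from this[of N] have "t1 powr mu * v t1 (y 0)
      \<le> \<tau> N powr mu * v (\<tau> N) (y N) + C * (\<Sum>j=1..N. S j)"
    by simp
  moreover have "\<tau> N = t2"
    using assms(4) by (simp add: \<tau>_def)
  ultimately show ?thesis
    by (simp add: C_def S_def)
qed

end

section \<open>Paths in the induced graph, distance and minimal weight\<close>

text \<open>Translates a list of arcs into an indexed vertex sequence, which has one entry more than
  the list.\<close>

lemma pcas_nth:
  assumes "pcas x p y"
  shows "length (pawalk_verts x p) = Suc (length p) \<and> pawalk_verts x p ! 0 = x
    \<and> pawalk_verts x p ! length p = y
    \<and> (\<forall>i<length p. p ! i = (pawalk_verts x p ! i, pawalk_verts x p ! Suc i))"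
  using assms
proof (induction p arbitrary: x)
  case (Cons e p)
  then show ?case
    using Cons.IH[of "snd e"] by (auto simp: nth_Cons' less_Suc_eq_0_disj prod_eq_iff)
qed simp

lemma apath_induced_graph_vertices:
  assumes "pre_digraph.apath (with_proj (induced_graph X k)) x p y"
  obtains z where "\<And>i. i \<le> length p \<Longrightarrow> z i \<in> X" "z 0 = x" "z (length p) = y"
    "\<And>i. i < length p \<Longrightarrow> 0 < k (z i) (z (Suc i))"
proof
  let ?z = "\<lambda>i. pawalk_verts x p ! i"
  have x: "x \<in> X" and arcs: "set p \<subseteq> {(x, y). x \<in> X \<and> y \<in> X \<and> 0 < k x y}"
    and p: "pcas x p y"
    using assms
    by (auto simp: pre_digraph.apath_def pre_digraph.awalk_def cas_with_proj_eq induced_graph_def)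
  note nth = pcas_nth[OF p]
  have arc: "?z i \<in> X \<and> ?z (Suc i) \<in> X \<and> 0 < k (?z i) (?z (Suc i))" if "i < length p" for i
    using arcs nth nth_mem[OF that] that by auto
  show "?z 0 = x" "?z (length p) = y"
    using nth by auto
  show "0 < k (?z i) (?z (Suc i))" if "i < length p" for i
    using arc[OF that] by simp
  show "?z i \<in> X" if "i \<le> length p" for i
    \<comment> \<open>For \<open>i > 0\<close> the vertex is the head of arc \<open>i - 1\<close>;
      for \<open>i = 0\<close> it is \<open>x\<close>, which also covers the empty path.\<close>
    using arc[of "i - 1"] x nth that by (cases i) auto
qed

text \<open>Symmetry of \<open>k\<close> turns connectedness into strong connectedness, so some path
  exists and the \<open>LEAST\<close> in \<open>graph_dist\<close> is attained.\<close>

lemma graph_dist_apath: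
  assumes "\<And>x y. x \<in> X \<Longrightarrow> y \<in> X \<Longrightarrow> k x y = k y x"
    and "Digraph_Component.connected (with_proj (induced_graph X k))" and "x \<in> X" "y \<in> X"
  obtains p where "pre_digraph.apath (with_proj (induced_graph X k)) x p y"
    "length p = graph_dist X k x y"
proof -
  interpret wf_digraph "with_proj (induced_graph X k)"
    by unfold_locales (auto simp: induced_graph_def)
  have "symmetric (with_proj (induced_graph X k))"
    using assms(1) by (auto simp: symmetric_def induced_graph_def sym_def)
  then have "strongly_connected (with_proj (induced_graph X k))"
    using assms(2) by (rule symmetric_connected_imp_strongly_connected)
  then have "\<exists>p. apath x p y"
    unfolding reachable_apath[symmetric] using assms(3,4)
    by (simp add: strongly_connected_def induced_graph_def)
  then have "\<exists>n p. apath x p y \<and> length p = n"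
    by blast
  then have "\<exists>p. apath x p y \<and> length p = graph_dist X k x y"
    unfolding graph_dist_def by (rule LeastI_ex)
  then show thesis
    using that by blast
qed

text \<open>The given edge shows that the set of positive weights is nonempty, and it is finite as a
  subset of an image of \<open>X \<times> X\<close>; hence \<open>Min\<close> is a genuine
  minimum.\<close>

lemma k_min_le:
  assumes "finite X" "x \<in> X" "y \<in> X" "0 < k x y"
  shows "k_min X k \<le> k x y" "0 < k_min X k"
proof -
  have eq: "{k x y | x y. x \<in> X \<and> y \<in> X \<and> k x y > 0} \<subseteq> (\<lambda>(x, y). k x y) ` (X \<times> X)"
    by auto
  have fin: "finite {k x y | x y. x \<in> X \<and> y \<in> X \<and> k x y > 0}"
    by (rule finite_subset[OF eq]) (use assms in auto)
  show "k_min X k \<le> k x y"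
    unfolding k_min_def by (rule Min_le[OF fin]) (use assms in blast)
  show "0 < k_min X k"
    unfolding k_min_def by (subst Min_gr_iff[OF fin]) (use assms in blast)+
qed

lemma (in li_yau_inequality) harnack_apath:
  assumes "0 < t1" "t1 < t2" and path: "pre_digraph.apath (with_proj (induced_graph X k)) x p y"
  shows "t1 powr mu * v t1 x \<le> t2 powr mu * v t2 y
      + 2 * (real (length p))\<^sup>2 * (t2 powr (mu + 1) - t1 powr (mu + 1))
        / ((1 - lam) * (mu + 1) * k_min X k * (t2 - t1)\<^sup>2)"
proof -
  obtain z where z: "\<And>i. i \<le> length p \<Longrightarrow> z i \<in> X" "z 0 = x" "z (length p) = y"
    and edge: "\<And>i. i < length p \<Longrightarrow> 0 < k (z i) (z (Suc i))"
    using path by (rule apath_induced_graph_vertices) blast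
  \<comment> \<open>The path estimate requires at least one edge. A path of length 0 has
    \<open>x = y\<close> and error term 0.\<close>
  show ?thesis
  proof (cases "length p = 0")
    case True
    then show ?thesis
      using harnack_vertex[OF assms(1,2), of x] z by auto
  next
    case False
    define N where "N = length p"
    define \<tau> where "\<tau> = (\<lambda>i::nat. t1 + real i * ((t2 - t1) / real N))"
    define C where "C = 2 * (real N)\<^sup>2 / ((1 - lam) * (mu + 1) * (t2 - t1)\<^sup>2)"
    define P where "P = (\<lambda>j. \<tau> j powr (mu + 1))"
    have N: "1 \<le> N"
      using False by (simp add: N_def Suc_le_eq)
    have "0 \<le> C"
      using lam mu by (simp add: C_def)
    have \<tau>: "\<tau> i \<le> \<tau> j" "0 < \<tau> i" if "i \<le> j" for i j
      using assms that by (auto simp: \<tau>_def add_pos_nonneg intro!: mult_right_mono divide_right_mono)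
    have ends: "P N = t2 powr (mu + 1)" "P 0 = t1 powr (mu + 1)"
      using N by (auto simp: \<tau>_def P_def)
    have "t1 powr mu * v t1 x \<le> t2 powr mu * v t2 y
        + C * (\<Sum>j=1..N. (P j - P (j - 1)) / k (z (j - 1)) (z j))"
      using harnack_path[OF assms(1,2) N, of z] z edge
      by (simp add: N_def[symmetric] C_def P_def \<tau>_def)
    \<comment> \<open>The increments of \<open>P\<close> are nonnegative, so lowering each weight to
      \<open>k_min X k\<close> enlarges the sum, which then telescopes.\<close>
    moreover have "(\<Sum>j=1..N. (P j - P (j - 1)) / k (z (j - 1)) (z j))
        \<le> (\<Sum>j=1..N. (P j - P (j - 1)) / k_min X k)"
    proof (rule sum_mono)
      fix j assume j: "j \<in> {1..N}"
      then have e: "0 < k (z (j - 1)) (z j)" "z (j - 1) \<in> X" "z j \<in> X"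
        using edge[of "j - 1"] z(1)[of "j - 1"] z(1)[of j] by (auto simp: N_def)
      have "P (j - 1) \<le> P j"
        unfolding P_def using \<tau>[of "j - 1" j] mu by (intro powr_mono2) auto
      then show "(P j - P (j - 1)) / k (z (j - 1)) (z j) \<le> (P j - P (j - 1)) / k_min X k"
        using k_min_le[of X "z (j - 1)" "z j" k] finite e by (intro divide_left_mono) auto
    qed
    moreover have "(\<Sum>j=1..N. (P j - P (j - 1)) / k_min X k) = (P N - P 0) / k_min X k"
      using sum_telescope''[of 0 N P] by (simp add: sum_divide_distrib[symmetric])
    ultimately have "t1 powr mu * v t1 x \<le> t2 powr mu * v t2 y + C * ((P N - P 0) / k_min X k)"
      using \<open>0 \<le> C\<close> by (smt (verit) mult_left_mono)
    then show ?thesis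
      unfolding ends by (simp add: C_def N_def mult_ac)
  qed
qed

section \<open>Transfer from \<open>u\<close> to \<open>v\<close> and conclusion\<close>

theorem theorem6p3:
  fixes X :: "'a set" and k :: "'a \<Rightarrow> 'a \<Rightarrow> real"
    and m lam mu t1 t2 :: real and x1 x2 :: 'a
    and u v :: "real \<Rightarrow> 'a \<Rightarrow> real"
  assumes "m > 1"
    and "finite X" and "X \<noteq> {}"
    and "\<And>x y. x \<in> X \<Longrightarrow> y \<in> X \<Longrightarrow> k x y \<ge> 0"
    and "\<And>x y. x \<in> X \<Longrightarrow> y \<in> X \<Longrightarrow> k x y = k y x"
    and "\<And>x. x \<in> X \<Longrightarrow> k x x = 0"
    and "\<exists>x\<in>X. \<exists>y\<in>X. k x y \<noteq> 0"
    and "Digraph_Component.connected (with_proj (induced_graph X k))"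
    and "\<And>t x. t \<ge> 0 \<Longrightarrow> x \<in> X \<Longrightarrow> u t x > 0"
    and "\<And>x. x \<in> X \<Longrightarrow> C1_on_halfline (\<lambda>t. u t x)"
    and "\<And>t x. t \<ge> 0 \<Longrightarrow> x \<in> X \<Longrightarrow> v t x = m / (m - 1) * u t x powr (m - 1)"
    and "0 \<le> lam" and "lam < 1" and "mu > 0"
    and "\<And>t x. t > 0 \<Longrightarrow> x \<in> X \<Longrightarrow>
           deriv (\<lambda>s. v s x) t \<ge> (1 - lam) * Psi_Upsilon X k m (v t) x - mu / t * v t x"
    and "0 < t1" and "t1 < t2"
    and "x1 \<in> X" and "x2 \<in> X"
  shows "(\<forall>N::nat. \<forall>y::nat \<Rightarrow> 'a.
            N \<ge> 1 \<and> (\<forall>i\<le>N. y i \<in> X) \<and> inj_on y {0..N} \<and> y 0 = x1 \<and> y N = x2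
              \<and> (\<forall>i\<in>{1..N}. k (y (i - 1)) (y i) > 0) \<longrightarrow>
            (let \<tau> = (\<lambda>i::nat. t1 + real i * ((t2 - t1) / real N)) in
             t1 powr mu * v t1 x1
               \<le> t2 powr mu * v t2 x2
                 + 2 * (real N)\<^sup>2 / ((1 - lam) * (mu + 1) * (t2 - t1)\<^sup>2)
                   * (\<Sum>j=1..N. (\<tau> j powr (mu + 1) - \<tau> (j - 1) powr (mu + 1)) / k (y (j - 1)) (y j))))
       \<and> t1 powr mu * v t1 x1
           \<le> t2 powr mu * v t2 x2
             + 2 * (real (graph_dist X k x1 x2))\<^sup>2 * (t2 powr (mu + 1) - t1 powr (mu + 1))
               / ((1 - lam) * (mu + 1) * k_min X k * (t2 - t1)\<^sup>2)"
proof -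
  define v' where "v' = (\<lambda>x t. deriv (\<lambda>s. v s x) t)"
  have der: "((\<lambda>s. v s x) has_real_derivative v' x t) (at t)" if t: "0 < t" and x: "x \<in> X" for t x
  proof -
    obtain f' where "\<forall>t\<ge>0. ((\<lambda>s. u s x) has_real_derivative f' t) (at t within {0..})"
      using assms(10)[OF x] unfolding C1_on_halfline_def by blast
    then have "((\<lambda>s. u s x) has_real_derivative f' t) (at t within {0..})"
      using t by simp
    \<comment> \<open>At \<open>t > 0\<close> the derivative relative to the closed half-line is
      two-sided.\<close>
    moreover have "at t within {0..} = at t"
      using t by (intro at_within_interior) simp
    ultimately have du: "((\<lambda>s. u s x) has_real_derivative f' t) (at t)"
      by simp
    have "0 < u t x"
      using t x by (intro assms(9)) auto
    then have "((\<lambda>s. m / (m - 1) * u s x powr (m - 1)) has_real_derivative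
        m / (m - 1) * ((m - 1) * u t x powr (m - 1 - of_nat 1) * f' t)) (at t)"
      by (intro DERIV_cmult DERIV_fun_powr du)
    \<comment> \<open>\<open>v\<close> is given by the power of \<open>u\<close> at nonnegative
      times, hence on the open set \<open>{0<..}\<close> around \<open>t\<close>.\<close>
    then have "((\<lambda>s. v s x) has_real_derivative
        m / (m - 1) * ((m - 1) * u t x powr (m - 1 - of_nat 1) * f' t)) (at t)"
      by (rule has_field_derivative_transform_within_open[of _ _ _ "{0<..}"])
        (use t x in \<open>auto simp: assms(11)\<close>)
    then show ?thesis
      unfolding v'_def by (metis DERIV_imp_deriv)
  qed
  interpret li_yau_inequality X k m lam mu v v'
  proof (rule li_yau_inequality.intro)
    show "1 < m" "finite X" "lam < 1" "0 < mu"
      by (fact assms)+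
    show "0 \<le> k x y" "k x y = k y x" if "x \<in> X" "y \<in> X" for x y
      using assms(4,5) that by blast+
    show "((\<lambda>s. v s x) has_real_derivative v' x t) (at t)" if "0 < t" "x \<in> X" for t x
      using that by (rule der)
    show "0 < v t x" if "0 < t" "x \<in> X" for t x
      using that assms(1) assms(9)[of t x] by (subst assms(11)) auto
    show "(1 - lam) * Psi_Upsilon X k m (v t) x - mu / t * v t x \<le> v' x t" if "0 < t" "x \<in> X" for t x
      unfolding v'_def using that by (rule assms(15))
  qed
  \<comment> \<open>A shortest path makes the edge count in \<open>harnack_apath\<close> equal to
    the distance.\<close>
  obtain p where "pre_digraph.apath (with_proj (induced_graph X k)) x1 p x2"
    "length p = graph_dist X k x1 x2"
    using graph_dist_apath[OF assms(5,8) \<open>x1 \<in> X\<close> \<open>x2 \<in> X\<close>] by blast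
  with harnack_apath[OF \<open>0 < t1\<close> \<open>t1 < t2\<close>, of x1 p x2] have dist: "t1 powr mu * v t1 x1 \<le> t2 powr mu * v t2 x2
             + 2 * (real (graph_dist X k x1 x2))\<^sup>2 * (t2 powr (mu + 1) - t1 powr (mu + 1))
               / ((1 - lam) * (mu + 1) * k_min X k * (t2 - t1)\<^sup>2)"
    by simp
  show ?thesis
  proof (rule conjI[OF _ dist], intro allI impI, elim conjE)
    fix N :: nat and y :: "nat \<Rightarrow> 'a"
    assume N: "1 \<le> N" and y: "\<forall>i\<le>N. y i \<in> X" "y 0 = x1" "y N = x2"
      and edge: "\<forall>i\<in>{1..N}. k (y (i - 1)) (y i) > 0"
    have "0 < k (y i) (y (Suc i))" if "i < N" for i
      using bspec[OF edge, of "Suc i"] that by simp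
    with harnack_path[OF \<open>0 < t1\<close> \<open>t1 < t2\<close> N, of y] y
    show "let \<tau> = (\<lambda>i::nat. t1 + real i * ((t2 - t1) / real N)) in
             t1 powr mu * v t1 x1
               \<le> t2 powr mu * v t2 x2
                 + 2 * (real N)\<^sup>2 / ((1 - lam) * (mu + 1) * (t2 - t1)\<^sup>2)
                   * (\<Sum>j=1..N. (\<tau> j powr (mu + 1) - \<tau> (j - 1) powr (mu + 1)) / k (y (j - 1)) (y j))"
      by (simp only: Let_def)
  qed
qed

end
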